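(* Consider a combinatorial min-max problem: an instance consists of a nonempty feasible set $\mathcal{X}\subseteq\{0,1\}^n$ (from some fixed problem class, given by a compact encoding) together with scenarios $c_1,\dots,c_K\in\mathbb{R}^n_{\ge0}$, and the goal is $\min_{x\in\mathcal{X}}\max_{i\in[K]}c_i^tx$. Suppose that for every fixed number of scenarios $\tilde K$ there is a polynomial-time algorithm that returns a $2$-approximation for instances with $\tilde K$ scenarios. Then for every constant $0<\varepsilon\le1$ there is a polynomial-time algorithm (polynomial in the input size, with $K$ unbounded) which returns a feasible solution $x'\in\mathcal{X}$ with $\max_{i\in[K]}c_i^tx'\le\varepsilon K\min_{x\in\mathcal{X}}\max_{i\in[K]}c_i^tx$.
   Context: An $\alpha$-approximation is a feasible solution whose min-max objective value is at most $\alpha$ times the optimal value.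
   Formalization: The bound max c_i^t x' ≤ εK·min max c_i^t x is claimed only when εK ≥ 2 (for smaller K only a feasible x' in polynomial time); without this it is false, e.g. K=1, ε=1/2, X={(1)}, c_1=(1). *)

theory Defs
  imports
    "Jordan_Normal_Form.Matrix"
    "HOL-Library.Log_Nat"
    "HOL-Computational_Algebra.Polynomial"
begin

section \<open>Machine model\<close>

text \<open>
  Algorithms are WHILE programs over binary trees, in the style of N. D. Jones' WHILE language, whose
  leaves may also hold numbers.  Tree operations have unit cost (trees are shared, so they are pointer
  operations).  Arithmetic is charged according to a cost model:

  \<^item> \<open>Real_Arith\<close>: numbers are arbitrary reals, every arithmetic operation and comparison has
    constant cost (real RAM, Blum--Shub--Smale);
  \<^item> \<open>Bit_Arith\<close>: numbers are rationals in lowest terms, written in binary, and operations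
    are charged the bit lengths of operands and result (logarithmic cost).  Polynomial time is then
    polynomial time on Turing machines; no primitive for rounding or for reading off numerator and
    denominator is needed, since doubling, comparison and continued fractions provide these in
    polynomial time.
\<close>

datatype cost_model = Real_Arith | Bit_Arith

fun numbers :: "cost_model \<Rightarrow> real set" where
  "numbers Real_Arith = UNIV"
| "numbers Bit_Arith = \<rat>"

definition rat_bits :: "rat \<Rightarrow> nat" where
  "rat_bits r = (case quotient_of r of (p, q) \<Rightarrow> floorlog 2 (nat \<bar>p\<bar>) + floorlog 2 (nat q))"

text \<open>The value at an irrational number in the model \<open>Bit_Arith\<close> is immaterial: such numbers are not
  admitted in inputs, and programs cannot create them.\<close>

fun num_size :: "cost_model \<Rightarrow> real \<Rightarrow> nat" where
  "num_size Real_Arith x = 1"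
| "num_size Bit_Arith x = rat_bits (THE r. real_of_rat r = x)"

datatype (scalars: 'a) tree = Leaf | Scalar 'a | Node "'a tree" "'a tree"

fun tree_size :: "cost_model \<Rightarrow> real tree \<Rightarrow> nat" where
  "tree_size M Leaf = 1"
| "tree_size M (Scalar x) = 1 + num_size M x"
| "tree_size M (Node l r) = 1 + tree_size M l + tree_size M r"

type_synonym state = "nat \<Rightarrow> real tree"

datatype arith = Add | Sub | Mul | Div

fun arith_op :: "arith \<Rightarrow> real \<Rightarrow> real \<Rightarrow> real" where
  "arith_op Add x y = x + y"
| "arith_op Sub x y = x - y"
| "arith_op Mul x y = x * y"
| "arith_op Div x y = x / y"

text \<open>Operands of expressions and tests are variables, i.e. natural numbers.  An operation applied to
  an operand of the wrong shape yields \<open>Leaf\<close>, a comparison yields \<open>False\<close>.\<close>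

datatype expr =
    Var nat | Mk_Leaf | Zero | One | Mk_Node nat nat | Left nat | Right nat | Arith arith nat nat

fun eval :: "expr \<Rightarrow> state \<Rightarrow> real tree" where
  "eval (Var x) s = s x"
| "eval Mk_Leaf s = Leaf"
| "eval Zero s = Scalar 0"
| "eval One s = Scalar 1"
| "eval (Mk_Node x y) s = Node (s x) (s y)"
| "eval (Left x) s = (case s x of Node l r \<Rightarrow> l | _ \<Rightarrow> Leaf)"
| "eval (Right x) s = (case s x of Node l r \<Rightarrow> r | _ \<Rightarrow> Leaf)"
| "eval (Arith f x y) s = (case (s x, s y) of (Scalar a, Scalar b) \<Rightarrow> Scalar (arith_op f a b) | _ \<Rightarrow> Leaf)"

fun expr_cost :: "cost_model \<Rightarrow> expr \<Rightarrow> state \<Rightarrow> nat" where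
  "expr_cost M (Arith f x y) s =
     (case (s x, s y) of
        (Scalar a, Scalar b) \<Rightarrow> 1 + num_size M a + num_size M b + num_size M (arith_op f a b)
      | _ \<Rightarrow> 1)"
| "expr_cost M _ s = 1"

datatype test = Is_Node nat | Is_Scalar nat | Less nat nat

fun holds :: "test \<Rightarrow> state \<Rightarrow> bool" where
  "holds (Is_Node x) s = (case s x of Node l r \<Rightarrow> True | _ \<Rightarrow> False)"
| "holds (Is_Scalar x) s = (case s x of Scalar a \<Rightarrow> True | _ \<Rightarrow> False)"
| "holds (Less x y) s = (case (s x, s y) of (Scalar a, Scalar b) \<Rightarrow> a < b | _ \<Rightarrow> False)"

fun test_cost :: "cost_model \<Rightarrow> test \<Rightarrow> state \<Rightarrow> nat" where
  "test_cost M (Less x y) s =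
     (case (s x, s y) of (Scalar a, Scalar b) \<Rightarrow> 1 + num_size M a + num_size M b | _ \<Rightarrow> 1)"
| "test_cost M _ s = 1"

datatype program =
    Assign nat expr
  | Seq program program
  | If test program program
  | While test program

text \<open>\<open>runs M c s t s'\<close>: started in state \<open>s\<close>, program \<open>c\<close> terminates in state \<open>s'\<close> at total cost \<open>t\<close>.\<close>

inductive runs :: "cost_model \<Rightarrow> program \<Rightarrow> state \<Rightarrow> nat \<Rightarrow> state \<Rightarrow> bool" for M where
  Assign: "runs M (Assign x e) s (expr_cost M e s) (s(x := eval e s))"
| Seq: "runs M c1 s t1 s1 \<Longrightarrow> runs M c2 s1 t2 s2 \<Longrightarrow> runs M (Seq c1 c2) s (t1 + t2) s2"
| If_True: "holds b s \<Longrightarrow> runs M c1 s t s1 \<Longrightarrow> runs M (If b c1 c2) s (test_cost M b s + t) s1"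
| If_False: "\<not> holds b s \<Longrightarrow> runs M c2 s t s1 \<Longrightarrow> runs M (If b c1 c2) s (test_cost M b s + t) s1"
| While_True: "holds b s \<Longrightarrow> runs M c s t1 s1 \<Longrightarrow> runs M (While b c) s1 t2 s2
    \<Longrightarrow> runs M (While b c) s (test_cost M b s + t1 + t2) s2"
| While_False: "\<not> holds b s \<Longrightarrow> runs M (While b c) s (test_cost M b s) s"

inductive_cases AssignE: "runs M (Assign x e) s t s'"
inductive_cases SeqE: "runs M (Seq c1 c2) s t s'"
inductive_cases IfE: "runs M (If b c1 c2) s t s'"
inductive_cases WhileE: "runs M (While b c) s t s'"

lemma runs_deterministic:
  assumes "runs M c s t s'" "runs M c s u s''"
  shows "u = t \<and> s'' = s'"
  using assms
proof (induction arbitrary: u s'' rule: runs.induct)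
  case (Assign x e s)
  then show ?case by (auto elim: AssignE)
next
  case (Seq c1 s t1 s1 c2 t2 s2)
  from Seq.prems show ?case by (rule SeqE) (use Seq.IH in blast)
next
  case (If_True b s c1 t s1 c2)
  from If_True.prems show ?case by (rule IfE) (use If_True in blast)+
next
  case (If_False b s c2 t s1 c1)
  from If_False.prems show ?case by (rule IfE) (use If_False in blast)+
next
  case (While_True b s c t1 s1 t2 s2)
  from While_True.prems show ?case by (rule WhileE) (use While_True in blast)+
next
  case (While_False b s c)
  from While_False.prems show ?case by (rule WhileE) (use While_False in blast)+
qed

text \<open>Variable 0 holds the input at the start and the output at the end.\<close>

definition init :: "real tree \<Rightarrow> state" where
  "init v = (\<lambda>_. Leaf)(0 := v)"

section \<open>Min-max problems\<close>

definition binary_vecs :: "nat \<Rightarrow> real vec set" where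
  "binary_vecs n = {x \<in> carrier_vec n. \<forall>i<n. x $ i \<in> {0, 1}}"

text \<open>A problem class is given by a set of codes; a code \<open>e\<close> describes a dimension \<open>n e\<close> and a feasible
  set \<open>X e\<close>.  Codes are trees, so that they may contain e.g. graphs, bit strings, or numerical data.\<close>

definition problem_class ::
    "cost_model \<Rightarrow> real tree set \<Rightarrow> (real tree \<Rightarrow> nat) \<Rightarrow> (real tree \<Rightarrow> real vec set) \<Rightarrow> bool" where
  "problem_class M codes n X \<longleftrightarrow>
     (\<forall>e\<in>codes. scalars e \<subseteq> numbers M \<and> X e \<noteq> {} \<and> X e \<subseteq> binary_vecs (n e))"

definition instances ::
    "cost_model \<Rightarrow> real tree set \<Rightarrow> (real tree \<Rightarrow> nat) \<Rightarrow> (real tree \<times> real vec list) set" where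
  "instances M codes n =
     {(e, cs). e \<in> codes \<and> cs \<noteq> [] \<and>
        (\<forall>c\<in>set cs. c \<in> carrier_vec (n e) \<and> (\<forall>j<n e. c $ j \<in> numbers M \<and> 0 \<le> c $ j))}"

definition max_cost :: "real vec list \<Rightarrow> real vec \<Rightarrow> real" where
  "max_cost cs x = (MAX i\<in>{..<length cs}. (cs ! i) \<bullet> x)"

definition minmax :: "real vec set \<Rightarrow> real vec list \<Rightarrow> real" where
  "minmax F cs = (MIN x\<in>F. max_cost cs x)"

definition approximation :: "real \<Rightarrow> real vec set \<Rightarrow> real vec list \<Rightarrow> real vec \<Rightarrow> bool" where
  "approximation \<alpha> F cs x \<longleftrightarrow> x \<in> F \<and> max_cost cs x \<le> \<alpha> * minmax F cs"

section \<open>Polynomial-time algorithms\<close>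

definition enc_list :: "real tree list \<Rightarrow> real tree" where
  "enc_list vs = foldr Node vs Leaf"

definition enc_vec :: "real vec \<Rightarrow> real tree" where
  "enc_vec v = enc_list (map Scalar (list_of_vec v))"

definition enc_instance :: "real tree \<times> real vec list \<Rightarrow> real tree" where
  "enc_instance I = Node (fst I) (enc_list (map enc_vec (snd I)))"

text \<open>There is a polynomial-time algorithm that returns, for each instance \<open>(e, cs)\<close> in \<open>S\<close>, a vector
  \<open>x\<close> with \<open>R e cs x\<close>.\<close>

definition polytime_solvable ::
    "cost_model \<Rightarrow> (real tree \<times> real vec list) set \<Rightarrow>
     (real tree \<Rightarrow> real vec list \<Rightarrow> real vec \<Rightarrow> bool) \<Rightarrow> bool" where
  "polytime_solvable M S R \<longleftrightarrow>
     (\<exists>(prog :: program) (p :: nat poly). \<forall>(e, cs)\<in>S. \<exists>t s x.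
        runs M prog (init (enc_instance (e, cs))) t s \<and>
        t \<le> poly p (tree_size M (enc_instance (e, cs))) \<and>
        s 0 = enc_vec x \<and> R e cs x)"

end

theory Submission
  imports Defs
begin

text \<open>
  Distribute the \<open>K\<close> scenarios evenly over \<open>k = \<lceil>4 / \<epsilon>\<rceil>\<close> groups and replace each group by the
  componentwise maximum of its members (the zero vector, if the group is empty).  This dominates every
  member and is dominated by the sum of the members, so passing to the groups does not decrease the
  cost of any solution and increases it by a factor of at most \<open>\<lceil>K / k\<rceil>\<close>.  A 2-approximation for
  the groups is therefore a \<open>2 \<lceil>K / k\<rceil>\<close>-approximation for the original scenarios, and
  \<open>2 \<lceil>K / k\<rceil> \<le> \<epsilon> K\<close> as soon as \<open>2 \<le> \<epsilon> K\<close>.  Taking maxima rather than sums means that no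
  arithmetic is performed, so that the bit lengths in the model \<open>Bit_Arith\<close> need no analysis.
\<close>

section \<open>Time-bounded runs\<close>

text \<open>Exact costs depend on branches taken and on number sizes; upper bounds suffice for
  polynomial time and simply add up under sequencing.\<close>

definition runs_within :: "cost_model \<Rightarrow> program \<Rightarrow> state \<Rightarrow> nat \<Rightarrow> state \<Rightarrow> bool" where
  "runs_within M c s T s' \<longleftrightarrow> (\<exists>t\<le>T. runs M c s t s')"

fun straight_line :: "program \<Rightarrow> bool" where
  "straight_line (Assign x e) = True"
| "straight_line (Seq c d) = (straight_line c \<and> straight_line d)"
| "straight_line (If b c d) = (straight_line c \<and> straight_line d)"
| "straight_line (While b c) = False"

text \<open>Result of a loop-free program as a function that the simplifier can evaluate. The
  \<open>While\<close> clause is a dummy for totality; \<open>exec\<close> is only used together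
  with \<open>straight_line\<close>.\<close>

fun exec :: "program \<Rightarrow> state \<Rightarrow> state" where
  "exec (Assign x e) s = s(x := eval e s)"
| "exec (Seq c d) s = exec d (exec c s)"
| "exec (If b c d) s = (if holds b s then exec c s else exec d s)"
| "exec (While b c) s = s"

fun exec_cost :: "cost_model \<Rightarrow> program \<Rightarrow> state \<Rightarrow> nat" where
  "exec_cost M (Assign x e) s = expr_cost M e s"
| "exec_cost M (Seq c d) s = exec_cost M c s + exec_cost M d (exec c s)"
| "exec_cost M (If b c d) s =
     test_cost M b s + (if holds b s then exec_cost M c s else exec_cost M d s)"
| "exec_cost M (While b c) s = 0"

lemma runs_straight_line: "straight_line c \<Longrightarrow> runs M c s (exec_cost M c s) (exec c s)"
  by (induction c arbitrary: s) (auto intro: runs.intros)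

lemma runs_within_straight_line:
  assumes "straight_line c" "exec_cost M c s \<le> T" "exec c s = s'"
  shows "runs_within M c s T s'"
  using assms runs_straight_line unfolding runs_within_def by blast

lemma runs_within_Seq:
  assumes "runs_within M c1 s T1 s1" "runs_within M c2 s1 T2 s2" "T1 + T2 \<le> T"
  shows "runs_within M (Seq c1 c2) s T s2"
proof -
  obtain t1 t2 where "t1 \<le> T1" "runs M c1 s t1 s1" "t2 \<le> T2" "runs M c2 s1 t2 s2"
    using assms(1,2) unfolding runs_within_def by blast
  then have "t1 + t2 \<le> T" "runs M (Seq c1 c2) s (t1 + t2) s2"
    using assms(3) by (auto intro: runs.Seq)
  then show ?thesis unfolding runs_within_def by blast
qed

lemma runs_within_While_True:
  assumes "holds b s" "runs_within M c s T1 s1" "runs_within M (While b c) s1 T2 s2"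
    and "test_cost M b s + T1 + T2 \<le> T"
  shows "runs_within M (While b c) s T s2"
proof -
  obtain t1 t2 where "t1 \<le> T1" "runs M c s t1 s1" "t2 \<le> T2" "runs M (While b c) s1 t2 s2"
    using assms(2,3) unfolding runs_within_def by blast
  then have "test_cost M b s + t1 + t2 \<le> T"
    "runs M (While b c) s (test_cost M b s + t1 + t2) s2"
    using assms(1,4) by (auto intro: runs.While_True)
  then show ?thesis unfolding runs_within_def by blast
qed

lemma runs_within_While_False:
  assumes "\<not> holds b s" "test_cost M b s \<le> T" "s' = s"
  shows "runs_within M (While b c) s T s'"
  using assms runs.While_False unfolding runs_within_def by blast

text \<open>The language has no skip command; assigning variable 6 to itself serves as one, at cost
  1.\<close>

fun seqs :: "program list \<Rightarrow> program" where
  "seqs [] = Assign 6 (Var 6)"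
| "seqs [c] = c"
| "seqs (c # d # cs) = Seq c (seqs (d # cs))"

text \<open>Variables are addressed by literals, so a program cannot compute the address
  \<open>8 + j\<close>. The loop is therefore unrolled, which is legitimate because the bound is a
  constant of the algorithm.\<close>

fun for_upto :: "(nat \<Rightarrow> program) \<Rightarrow> nat \<Rightarrow> program" where
  "for_upto c 0 = Assign 6 (Var 6)"
| "for_upto c (Suc j) = Seq (for_upto c j) (c j)"

section \<open>Row vectors as lists\<close>

abbreviation enc_row :: "real list \<Rightarrow> real tree" where
  "enc_row xs \<equiv> enc_list (map Scalar xs)"

lemma enc_list_Nil [simp]: "enc_list [] = Leaf"
  and enc_list_Cons [simp]: "enc_list (t # ts) = Node t (enc_list ts)"
  by (simp_all add: enc_list_def)

text \<open>The loops build lists by pushing, so their specifications use \<open>fold\<close>; this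
  identifies the outcome as a reversed list.\<close>

lemma fold_Node_eq: "fold Node ts Leaf = enc_list (rev ts)"
  by (simp add: enc_list_def foldr_conv_fold)

lemma tree_size_enc_list: "tree_size M (enc_list ts) = 1 + (\<Sum>t\<leftarrow>ts. 1 + tree_size M t)"
  by (induction ts) auto

lemma tree_size_pos: "1 \<le> tree_size M t"
  by (cases t) auto

lemma length_le_tree_size_enc_row: "2 * length xs + 1 \<le> tree_size M (enc_row xs)"
  by (induction xs) auto

text \<open>Each maximum is one of its two arguments, so its size is at most the sum of their sizes
  in either cost model.\<close>

lemma tree_size_map2_max:
  "length xs = length ys \<Longrightarrow>
     tree_size M (enc_row (map2 max xs ys)) \<le> tree_size M (enc_row xs) + tree_size M (enc_row ys)"
  by (induction xs ys rule: list_induct2) (auto simp: max_def)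

section \<open>Grouping the scenarios\<close>

text \<open>Variable 1 holds the code, 2 the scenarios still to be processed, 3 and 4 the operands of a
  componentwise maximum, 5 its result in reverse order; 6 and 7 are scratch.\<close>

definition max_body :: "program list" where
  "max_body =
     [Assign 6 (Left 3), Assign 7 (Left 4),
      If (Less 6 7) (Assign 6 (Var 7)) (Assign 6 (Var 6)),
      Assign 5 (Mk_Node 6 5), Assign 3 (Right 3), Assign 4 (Right 4),
      Assign 6 Mk_Leaf, Assign 7 Mk_Leaf]"

definition max_loop :: program where
  "max_loop = While (Is_Node 3) (seqs max_body)"

definition reverse_body :: "program list" where
  "reverse_body =
     [Assign 6 (Left 5), Assign 3 (Mk_Node 6 3), Assign 5 (Right 5), Assign 6 Mk_Leaf]"

definition reverse_loop :: program where
  "reverse_loop = While (Is_Node 5) (seqs reverse_body)"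

text \<open>The row in variable 3 serves only as a counter for the dimension. All pushed entries are
  equal, so the order reversal caused by pushing is harmless.\<close>

definition zero_body :: "program list" where
  "zero_body = [Assign 6 Zero, Assign 5 (Mk_Node 6 5), Assign 3 (Right 3), Assign 6 Mk_Leaf]"

definition zero_loop :: program where
  "zero_loop = While (Is_Node 3) (seqs zero_body)"

text \<open>Variable 5 starts with arbitrary content, since every round pushes onto it and the
  induction hypothesis must apply to the longer list.\<close>

lemma runs_max_loop:
  assumes "length xs = length ys"
    and "s 3 = enc_row xs" "s 4 = enc_row ys" "s 6 = Leaf" "s 7 = Leaf"
  shows "runs_within M max_loop s (5 * (tree_size M (enc_row xs) + tree_size M (enc_row ys)))
    (s(3 := Leaf, 4 := Leaf, 5 := fold Node (map Scalar (map2 max xs ys)) (s 5)))"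
  using assms
proof (induction xs ys arbitrary: s rule: list_induct2)
  case Nil
  then show ?case by (auto simp: max_loop_def fun_eq_iff intro!: runs_within_While_False)
next
  case (Cons x xs y ys)
  let ?s = "s(3 := enc_row xs, 4 := enc_row ys, 5 := Node (Scalar (max x y)) (s 5))"
  let ?s2 = "s(6 := Scalar x, 7 := Scalar y)"
  have IH: "runs_within M max_loop ?s (5 * (tree_size M (enc_row xs) + tree_size M (enc_row ys)))
     (?s(3 := Leaf, 4 := Leaf, 5 := fold Node (map Scalar (map2 max xs ys)) (?s 5)))"
    by (rule Cons.IH) (use Cons.prems in auto)
  show ?case
    unfolding max_loop_def
  proof (rule runs_within_While_True)
    \<comment> \<open>Eight assignments, one of them in the conditional, and a comparison that costs
      1 plus the sizes of \<open>x\<close> and \<open>y\<close>.\<close>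
    show "runs_within M (seqs max_body) s (9 + num_size M x + num_size M y) ?s"
      by (rule runs_within_straight_line)
        (use Cons.prems in \<open>auto simp: max_body_def fun_eq_iff max_def\<close>)
    show "runs_within M (While (Is_Node 3) (seqs max_body)) ?s
        (5 * (tree_size M (enc_row xs) + tree_size M (enc_row ys)))
        (s(3 := Leaf, 4 := Leaf,
           5 := fold Node (map Scalar (map2 max (x # xs) (y # ys))) (s 5)))"
      using IH unfolding max_loop_def by (simp add: fun_upd_twist)
  qed (use Cons.prems in auto)
qed

lemma runs_reverse_loop:
  assumes "s 5 = enc_list ts" "s 6 = Leaf"
  shows "runs_within M reverse_loop s (5 * length ts + 1) (s(3 := fold Node ts (s 3), 5 := Leaf))"
  using assms
proof (induction ts arbitrary: s)
  case Nil
  then show ?case by (auto simp: reverse_loop_def fun_eq_iff intro!: runs_within_While_False)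
next
  case (Cons t ts)
  let ?s = "s(3 := Node t (s 3), 5 := enc_list ts)"
  have IH: "runs_within M reverse_loop ?s (5 * length ts + 1)
      (?s(3 := fold Node ts (?s 3), 5 := Leaf))"
    by (rule Cons.IH) (use Cons.prems in auto)
  show ?case
    unfolding reverse_loop_def
  proof (rule runs_within_While_True)
    show "runs_within M (seqs reverse_body) s 4 ?s"
      by (rule runs_within_straight_line)
        (use Cons.prems in \<open>auto simp: reverse_body_def fun_eq_iff\<close>)
    show "runs_within M (While (Is_Node 5) (seqs reverse_body)) ?s (5 * length ts + 1)
        (s(3 := fold Node (t # ts) (s 3), 5 := Leaf))"
      using IH unfolding reverse_loop_def by (simp add: fun_upd_twist)
  qed (use Cons.prems in auto)
qed

lemma runs_zero_loop:
  assumes "s 3 = enc_list ts" "s 6 = Leaf"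
  shows "runs_within M zero_loop s (5 * length ts + 1)
    (s(3 := Leaf, 5 := fold Node (replicate (length ts) (Scalar 0)) (s 5)))"
  using assms
proof (induction ts arbitrary: s)
  case Nil
  then show ?case by (auto simp: zero_loop_def fun_eq_iff intro!: runs_within_While_False)
next
  case (Cons t ts)
  let ?s = "s(3 := enc_list ts, 5 := Node (Scalar 0) (s 5))"
  have IH: "runs_within M zero_loop ?s (5 * length ts + 1)
      (?s(3 := Leaf, 5 := fold Node (replicate (length ts) (Scalar 0)) (?s 5)))"
    by (rule Cons.IH) (use Cons.prems in auto)
  show ?case
    unfolding zero_loop_def
  proof (rule runs_within_While_True)
    show "runs_within M (seqs zero_body) s 4 ?s"
      by (rule runs_within_straight_line)
        (use Cons.prems in \<open>auto simp: zero_body_def fun_eq_iff\<close>)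
    show "runs_within M (While (Is_Node 3) (seqs zero_body)) ?s (5 * length ts + 1)
        (s(3 := Leaf, 5 := fold Node (replicate (length (t # ts)) (Scalar 0)) (s 5)))"
      using IH unfolding zero_loop_def by (simp add: fun_upd_twist)
  qed (use Cons.prems in auto)
qed

text \<open>The first loop delivers the maxima in reverse order; the second restores the order of
  the coordinates.\<close>

definition merge :: program where
  "merge = Seq max_loop reverse_loop"

lemma runs_merge:
  assumes "length xs = length ys"
    and "s 3 = enc_row xs" "s 4 = enc_row ys" "s 5 = Leaf" "s 6 = Leaf" "s 7 = Leaf"
  shows "runs_within M merge s (10 * (tree_size M (enc_row xs) + tree_size M (enc_row ys)))
    (s(3 := enc_row (map2 max xs ys), 4 := Leaf))"
  unfolding merge_def
proof (rule runs_within_Seq)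
  let ?zs = "rev (map Scalar (map2 max xs ys))"
  let ?s = "s(3 := Leaf, 4 := Leaf, 5 := enc_list ?zs)"
  show "runs_within M max_loop s (5 * (tree_size M (enc_row xs) + tree_size M (enc_row ys))) ?s"
    using runs_max_loop[OF assms(1-3,5,6), of M] by (simp only: assms(4) fold_Node_eq)
  have "runs_within M reverse_loop ?s (5 * length ?zs + 1)
      (?s(3 := fold Node ?zs (?s 3), 5 := Leaf))"
    by (rule runs_reverse_loop) (use assms in auto)
  moreover have "?s(3 := fold Node ?zs (?s 3), 5 := Leaf)
      = s(3 := enc_row (map2 max xs ys), 4 := Leaf)"
    using assms by (auto simp: fun_eq_iff fold_Node_eq)
  ultimately show "runs_within M reverse_loop ?s (5 * length xs + 1)
      (s(3 := enc_row (map2 max xs ys), 4 := Leaf))"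
    using assms(1) by simp
  \<comment> \<open>A row has more than twice as many tree nodes as entries, so the reversal fits
    into the second half of the budget.\<close>
  show "5 * (tree_size M (enc_row xs) + tree_size M (enc_row ys)) + (5 * length xs + 1)
      \<le> 10 * (tree_size M (enc_row xs) + tree_size M (enc_row ys))"
    using length_le_tree_size_enc_row[of xs M] tree_size_pos[of M "enc_row ys"] by simp
qed

text \<open>The accumulators of the groups are the variables \<open>8, \<dots>, 7 + k\<close>.  Instead of counting modulo
  \<open>k\<close>, every step merges into the first accumulator and then rotates all of them; variable \<open>8 + k\<close>
  is the spare slot of the rotation.\<close>

definition shift :: "nat \<Rightarrow> program" where
  "shift k = for_upto (\<lambda>j. Assign (8 + j) (Var (9 + j))) k"

definition spread :: "nat \<Rightarrow> program" where
  "spread k = for_upto (\<lambda>j. Assign (8 + j) (Var 5)) k"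

definition gather :: "nat \<Rightarrow> program" where
  "gather k = for_upto (\<lambda>j. Seq (Assign 3 (Mk_Node (8 + j) 3)) (Assign (8 + j) Mk_Leaf)) k"

text \<open>The assignments run in ascending order, so each variable is read before it is
  overwritten and the effect is that of a simultaneous shift. The extra 1 in the cost pays for the
  no-op at the base of \<open>for_upto\<close>.\<close>

lemma runs_shift:
  "runs_within M (shift k) s (k + 1) (\<lambda>v. if 8 \<le> v \<and> v < 8 + k then s (Suc v) else s v)"
  unfolding shift_def
proof (induction k)
  case 0
  show ?case by (auto simp: fun_eq_iff intro!: runs_within_straight_line)
next
  case (Suc k)
  show ?case
    by (simp, rule runs_within_Seq[OF Suc runs_within_straight_line[where T = 1]])
      (auto simp: fun_eq_iff)
qed

lemma runs_spread:
  "runs_within M (spread k) s (k + 1) (\<lambda>v. if 8 \<le> v \<and> v < 8 + k then s 5 else s v)"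
  unfolding spread_def
proof (induction k)
  case 0
  show ?case by (auto simp: fun_eq_iff intro!: runs_within_straight_line)
next
  case (Suc k)
  show ?case
    by (simp, rule runs_within_Seq[OF Suc runs_within_straight_line[where T = 1]])
      (auto simp: fun_eq_iff)
qed

text \<open>Pushing in ascending order lists the accumulators backwards. This explains the later
  \<open>rev\<close>, which is harmless as a maximum over scenarios ignores their order.\<close>

lemma runs_gather:
  "runs_within M (gather k) s (2 * k + 1)
     (\<lambda>v. if v = 3 then fold Node (map (\<lambda>j. s (8 + j)) [0..<k]) (s 3)
          else if 8 \<le> v \<and> v < 8 + k then Leaf else s v)"
  unfolding gather_def
proof (induction k)
  case 0
  show ?case by (auto simp: fun_eq_iff intro!: runs_within_straight_line)
next
  case (Suc k)
  show ?case
    by (simp, rule runs_within_Seq[OF Suc runs_within_straight_line[where T = 2]])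
      (auto simp: fun_eq_iff)
qed

section \<open>One round: merging a scenario and rotating the accumulators\<close>

definition step :: "real list list \<Rightarrow> real list \<Rightarrow> real list list" where
  "step L v = tl L @ [map2 max v (hd L)]"

abbreviation rows_size :: "cost_model \<Rightarrow> real list list \<Rightarrow> nat" where
  "rows_size M L \<equiv> (\<Sum>v\<leftarrow>L. tree_size M (enc_row v))"

text \<open>The merged row is parked in variable \<open>8 + k\<close>; the shift then drops the old
  first accumulator and moves the merged row into the last place.\<close>

definition step_prog :: "nat \<Rightarrow> program" where
  "step_prog k = Seq (Seq (Assign 3 (Left 2)) (Assign 4 (Var 8))) (Seq merge
     (Seq (Seq (Assign (8 + k) (Var 3)) (Assign 3 Mk_Leaf)) (Seq (shift k)
       (Seq (Assign (8 + k) Mk_Leaf) (Assign 2 (Right 2))))))"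

text \<open>\<open>acc_state d r L s\<close>: the code is \<open>d\<close>, the remaining scenarios are \<open>r\<close> and the accumulators are
  \<open>L\<close>; all scratch variables are clean.\<close>

definition acc_state :: "real tree \<Rightarrow> real list list \<Rightarrow> real list list \<Rightarrow> state \<Rightarrow> bool" where
  "acc_state d r L s \<longleftrightarrow> s 1 = d \<and> s 2 = enc_list (map enc_row r) \<and>
     (\<forall>v\<in>{3..7}. s v = Leaf) \<and> (\<forall>j<length L. s (8 + j) = enc_row (L ! j)) \<and>
     (\<forall>v\<ge>8 + length L. s v = Leaf)"

lemma runs_step_prog:
  assumes "acc_state d (v # r) L s" "L \<noteq> []" "length v = length (hd L)"
  shows "\<exists>s'. runs_within M (step_prog (length L)) s
      (10 * (tree_size M (enc_row v) + tree_size M (enc_row (hd L))) + length L + 7) s' \<and>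
    acc_state d r (step L v) s'"
proof -
  let ?k = "length L"
  let ?w = "enc_row (map2 max v (hd L))"
  let ?s1 = "s(3 := enc_row v, 4 := enc_row (hd L))"
  let ?s2 = "s(3 := ?w)"
  let ?s3 = "s(8 + ?k := ?w)"
  let ?s4 = "\<lambda>u. if 8 \<le> u \<and> u < 8 + ?k then ?s3 (Suc u) else ?s3 u"
  let ?s5 = "?s4(8 + ?k := Leaf, 2 := enc_list (map enc_row r))"
  have s: "s 1 = d" "s 2 = Node (enc_row v) (enc_list (map enc_row r))"
    "s 3 = Leaf" "s 4 = Leaf" "s 5 = Leaf" "s 6 = Leaf" "s 7 = Leaf" "s (8 + ?k) = Leaf"
    using assms(1) by (auto simp: acc_state_def)
  have acc: "s (8 + j) = enc_row (L ! j)" if "j < ?k" for j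
    using assms(1) that by (auto simp: acc_state_def)
  have s8: "s 8 = enc_row (hd L)"
    using acc[of 0] assms(2) by (simp add: hd_conv_nth)
  have 1: "runs_within M (Seq (Assign 3 (Left 2)) (Assign 4 (Var 8))) s 2 ?s1"
    by (rule runs_within_straight_line) (use s s8 in auto)
  have "runs_within M merge ?s1 (10 * (tree_size M (enc_row v) + tree_size M (enc_row (hd L))))
      (?s1(3 := ?w, 4 := Leaf))"
    by (rule runs_merge) (use s assms(3) in auto)
  moreover have "?s1(3 := ?w, 4 := Leaf) = ?s2"
    using s by (auto simp: fun_eq_iff)
  ultimately have 2: "runs_within M merge ?s1
      (10 * (tree_size M (enc_row v) + tree_size M (enc_row (hd L)))) ?s2"
    by simp
  have 3: "runs_within M (Seq (Assign (8 + ?k) (Var 3)) (Assign 3 Mk_Leaf)) ?s2 2 ?s3"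
    by (rule runs_within_straight_line) (use s in \<open>auto simp: fun_eq_iff\<close>)
  have 4: "runs_within M (shift ?k) ?s3 (?k + 1) ?s4"
    by (rule runs_shift)
  have 5: "runs_within M (Seq (Assign (8 + ?k) Mk_Leaf) (Assign 2 (Right 2))) ?s4 2 ?s5"
    by (rule runs_within_straight_line) (use s in \<open>auto simp: fun_eq_iff\<close>)
  have "acc_state d r (step L v) ?s5"
    unfolding acc_state_def
  proof (intro conjI allI ballI impI)
    fix j
    assume "j < length (step L v)"
    then have j: "j < ?k" using assms(2) by (simp add: step_def)
    show "?s5 (8 + j) = enc_row (step L v ! j)"
    proof (cases "Suc j < ?k")
      case True
      then show ?thesis using acc[of "Suc j"] by (auto simp: step_def nth_append nth_tl)
    next
      case False
      then have "Suc j = ?k" using j by simp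
      then show ?thesis by (auto simp: step_def nth_append)
    qed
  qed (use s assms(1,2) in \<open>auto simp: acc_state_def step_def\<close>)
  moreover have "runs_within M (step_prog ?k) s
      (10 * (tree_size M (enc_row v) + tree_size M (enc_row (hd L))) + ?k + 7) ?s5"
    unfolding step_prog_def
    by (rule runs_within_Seq[OF 1 runs_within_Seq[OF 2 runs_within_Seq[OF 3
      runs_within_Seq[OF 4 5 order_refl] order_refl] order_refl]]) simp
  ultimately show ?thesis by blast
qed

text \<open>An accumulator grows by at most the size of the row it absorbs. Hence the total size of
  unprocessed rows and accumulators never increases.\<close>

lemma rows_size_step:
  assumes "L \<noteq> []" "length v = length (hd L)"
  shows "rows_size M (step L v) \<le> rows_size M L + tree_size M (enc_row v)"
  using tree_size_map2_max[OF assms(2), of M] assms(1) by (cases L) (auto simp: step_def)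

lemma length_step [simp]: "L \<noteq> [] \<Longrightarrow> length (step L v) = length L"
  by (simp add: step_def)

lemma length_foldl_step: "L \<noteq> [] \<Longrightarrow> length (foldl step L vs) = length L"
  by (induction vs arbitrary: L) (auto simp: step_def)

text \<open>\<open>D\<close> bounds the non-increasing total size, and thereby both operands of
  every merge and all accumulators at the end.\<close>

lemma runs_step_loop:
  assumes "acc_state d vs L s" "L \<noteq> []" "\<forall>v\<in>set vs \<union> set L. length v = N"
    and "rows_size M vs + rows_size M L \<le> D"
  shows "\<exists>s'. runs_within M (While (Is_Node 2) (step_prog (length L))) s
      (length vs * (10 * D + length L + 8) + 1) s' \<and>
    acc_state d [] (foldl step L vs) s' \<and> rows_size M (foldl step L vs) \<le> D"
  using assms
proof (induction vs arbitrary: L s)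
  case Nil
  then have "runs_within M (While (Is_Node 2) (step_prog (length L))) s 1 s"
    by (auto simp: acc_state_def intro!: runs_within_While_False)
  with Nil show ?case by auto
next
  case (Cons v vs)
  have len: "length v = length (hd L)"
    using Cons.prems(2,3) by simp
  have ne: "step L v \<noteq> []" by (simp add: step_def)
  obtain s1 where s1: "runs_within M (step_prog (length L)) s
      (10 * (tree_size M (enc_row v) + tree_size M (enc_row (hd L))) + length L + 7) s1"
    "acc_state d vs (step L v) s1"
    using runs_step_prog[OF Cons.prems(1,2) len] by blast
  have "\<forall>u\<in>set vs \<union> set (step L v). length u = N"
    using Cons.prems(2,3) list.set_sel(2)[OF Cons.prems(2)] by (auto simp: step_def)
  moreover have "rows_size M vs + rows_size M (step L v) \<le> D"
    using rows_size_step[OF Cons.prems(2) len, of M] Cons.prems(4) by simp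
  ultimately obtain s2 where s2: "runs_within M (While (Is_Node 2) (step_prog (length L))) s1
      (length vs * (10 * D + length L + 8) + 1) s2"
    "acc_state d [] (foldl step (step L v) vs) s2" "rows_size M (foldl step (step L v) vs) \<le> D"
    using Cons.IH[OF s1(2) ne] Cons.prems(2) by auto
  have "tree_size M (enc_row (hd L)) \<le> rows_size M L"
    using Cons.prems(2) by (cases L) auto
  then have "tree_size M (enc_row v) + tree_size M (enc_row (hd L)) \<le> D"
    using Cons.prems(4) by simp
  then have "1 + (10 * (tree_size M (enc_row v) + tree_size M (enc_row (hd L))) + length L + 7)
      + (length vs * (10 * D + length L + 8) + 1)
      \<le> length (v # vs) * (10 * D + length L + 8) + 1"
    by simp
  moreover have "holds (Is_Node 2) s"
    using Cons.prems(1) by (simp add: acc_state_def)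
  ultimately have "runs_within M (While (Is_Node 2) (step_prog (length L))) s
      (length (v # vs) * (10 * D + length L + 8) + 1) s2"
    using runs_within_While_True[OF _ s1(1) s2(1)] by simp
  then show ?case using s2(2,3) by auto
qed

section \<open>The complete grouping program\<close>

definition setup_prog :: "nat \<Rightarrow> program" where
  "setup_prog k = Seq (Seq (Assign 1 (Left 0)) (Seq (Assign 2 (Right 0)) (Assign 3 (Left 2))))
     (Seq zero_loop (Seq (spread k) (Assign 5 Mk_Leaf)))"

definition finish_prog :: "nat \<Rightarrow> program" where
  "finish_prog k = Seq (gather k)
     (Seq (Assign 0 (Mk_Node 1 3)) (Seq (Assign 1 Mk_Leaf) (Assign 3 Mk_Leaf)))"

definition group_prog :: "nat \<Rightarrow> program" where
  "group_prog k = Seq (setup_prog k) (Seq (While (Is_Node 2) (step_prog k)) (finish_prog k))"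

lemma runs_setup_prog:
  assumes "vs \<noteq> []"
  shows "\<exists>s'. runs_within M (setup_prog k) (init (Node d (enc_list (map enc_row vs))))
      (5 * length (hd vs) + k + 6) s' \<and>
    acc_state d vs (replicate k (replicate (length (hd vs)) 0)) s'"
proof -
  let ?s0 = "init (Node d (enc_list (map enc_row vs)))"
  let ?z = "enc_row (replicate (length (hd vs)) 0)"
  let ?s1 = "?s0(1 := d, 2 := enc_list (map enc_row vs), 3 := enc_row (hd vs))"
  let ?s2 = "?s1(3 := Leaf, 5 := ?z)"
  let ?s3 = "\<lambda>v. if 8 \<le> v \<and> v < 8 + k then ?s2 5 else ?s2 v"
  let ?s4 = "?s3(5 := Leaf)"
  have 1: "runs_within M (Seq (Assign 1 (Left 0)) (Seq (Assign 2 (Right 0)) (Assign 3 (Left 2))))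
      ?s0 3 ?s1"
    by (rule runs_within_straight_line) (use assms in \<open>cases vs; auto simp: init_def\<close>)+
  have "runs_within M zero_loop ?s1 (5 * length (map Scalar (hd vs)) + 1)
      (?s1(3 := Leaf, 5 := fold Node (replicate (length (map Scalar (hd vs))) (Scalar 0)) (?s1 5)))"
    by (rule runs_zero_loop) (auto simp: init_def)
  moreover have "fold Node (replicate (length (map Scalar (hd vs))) (Scalar 0)) (?s1 5) = ?z"
    by (simp add: init_def fold_Node_eq del: fold_replicate)
  ultimately have 2: "runs_within M zero_loop ?s1 (5 * length (hd vs) + 1) ?s2"
    by simp
  have 3: "runs_within M (spread k) ?s2 (k + 1) ?s3"
    by (rule runs_spread)
  have 4: "runs_within M (Assign 5 Mk_Leaf) ?s3 1 ?s4"
    by (rule runs_within_straight_line) auto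
  have "runs_within M (setup_prog k) ?s0 (5 * length (hd vs) + k + 6) ?s4"
    unfolding setup_prog_def
    by (rule runs_within_Seq[OF 1 runs_within_Seq[OF 2 runs_within_Seq[OF 3 4 order_refl] order_refl]])
      simp
  moreover have "acc_state d vs (replicate k (replicate (length (hd vs)) 0)) ?s4"
    by (auto simp: acc_state_def init_def)
  ultimately show ?thesis by blast
qed

text \<open>The assumed 2-approximation program is only known to work from an \<open>init\<close>
  state, so every variable other than 0 must be \<open>Leaf\<close> again. This is why all loops
  clean their scratch variables.\<close>

lemma runs_finish_prog:
  assumes "acc_state d [] L s"
  shows "runs_within M (finish_prog (length L)) s (2 * length L + 4)
    (init (Node d (enc_list (map enc_row (rev L)))))"
proof -
  let ?k = "length L"
  let ?s1 = "\<lambda>v. if v = 3 then fold Node (map (\<lambda>j. s (8 + j)) [0..<?k]) (s 3)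
          else if 8 \<le> v \<and> v < 8 + ?k then Leaf else s v"
  have s: "s 1 = d" "s 2 = Leaf" "s 3 = Leaf" "\<forall>v\<in>{3..7}. s v = Leaf"
    "\<forall>v\<ge>8 + ?k. s v = Leaf" "\<forall>j<?k. s (8 + j) = enc_row (L ! j)"
    using assms by (auto simp: acc_state_def)
  have "map (\<lambda>j. s (8 + j)) [0..<?k] = map enc_row L"
    using s(6) by (auto intro: nth_equalityI)
  then have 3: "?s1 3 = enc_list (map enc_row (rev L))"
    using s(3) by (simp add: fold_Node_eq rev_map)
  have clean: "?s1 v = Leaf" if v: "v \<ge> 2" "v \<noteq> 3" for v
  proof -
    consider "v = 2" | "v \<in> {3..7}" | "8 \<le> v \<and> v < 8 + ?k" | "v \<ge> 8 + ?k" using v(1) by fastforce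
    then show ?thesis using s v by cases auto
  qed
  have "runs_within M (Seq (Assign 0 (Mk_Node 1 3)) (Seq (Assign 1 Mk_Leaf) (Assign 3 Mk_Leaf)))
      ?s1 3 (init (Node d (enc_list (map enc_row (rev L)))))"
  proof (rule runs_within_straight_line)
    have "?s1(0 := Node (?s1 1) (?s1 3), 1 := Leaf, 3 := Leaf)
        = init (Node d (enc_list (map enc_row (rev L))))"
    proof
      fix v :: nat
      consider "v = 0" | "v = 1" | "v = 3" | "v \<ge> 2" "v \<noteq> 3" by linarith
      then show "(?s1(0 := Node (?s1 1) (?s1 3), 1 := Leaf, 3 := Leaf)) v
        = init (Node d (enc_list (map enc_row (rev L)))) v"
        using clean[of v] 3 s(1) by cases (auto simp: init_def)
    qed
    then show "exec (Seq (Assign 0 (Mk_Node 1 3)) (Seq (Assign 1 Mk_Leaf) (Assign 3 Mk_Leaf))) ?s1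
        = init (Node d (enc_list (map enc_row (rev L))))"
      by simp
  qed auto
  then show ?thesis
    unfolding finish_prog_def by (rule runs_within_Seq[OF runs_gather]) simp
qed

definition groups :: "nat \<Rightarrow> real list list \<Rightarrow> real list list" where
  "groups k vs = foldl step (replicate k (replicate (length (hd vs)) 0)) vs"

lemma length_groups: "k \<ge> 1 \<Longrightarrow> length (groups k vs) = k"
  unfolding groups_def by (subst length_foldl_step) auto

lemma tree_size_zero_row:
  "tree_size M (enc_row (replicate m 0)) = 1 + m * (2 + num_size M 0)"
  by (induction m) auto

text \<open>The second claim bounds the output size: the running time of the 2-approximation program
  is polynomial in the size of the grouped instance, not of the original one.\<close>

lemma runs_group_prog:
  assumes "vs \<noteq> []" "\<forall>v\<in>set vs. length v = N" "k \<ge> 1"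
    and "rows_size M vs + k * tree_size M (enc_row (replicate N 0)) \<le> D"
  shows "runs_within M (group_prog k) (init (Node d (enc_list (map enc_row vs))))
      (5 * N + length vs * (10 * D + k + 8) + 3 * k + 11)
      (init (Node d (enc_list (map enc_row (rev (groups k vs))))))"
    and "rows_size M (groups k vs) \<le> D"
proof -
  let ?L = "replicate k (replicate (length (hd vs)) (0::real))"
  have N: "length (hd vs) = N" using assms(1,2) by simp
  obtain s1 where s1: "runs_within M (setup_prog k) (init (Node d (enc_list (map enc_row vs))))
      (5 * N + k + 6) s1" "acc_state d vs ?L s1"
    using runs_setup_prog[OF assms(1), of M k d] N by auto
  have "?L \<noteq> []" "\<forall>v\<in>set vs \<union> set ?L. length v = N" "rows_size M vs + rows_size M ?L \<le> D"
    using assms N by (auto simp: sum_list_replicate)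
  from runs_step_loop[OF s1(2) this] obtain s2
    where s2: "runs_within M (While (Is_Node 2) (step_prog k)) s1
        (length vs * (10 * D + k + 8) + 1) s2"
      "acc_state d [] (groups k vs) s2" "rows_size M (groups k vs) \<le> D"
    by (auto simp: groups_def)
  have s3: "runs_within M (finish_prog k) s2 (2 * k + 4)
      (init (Node d (enc_list (map enc_row (rev (groups k vs))))))"
    using runs_finish_prog[OF s2(2), of M] by (simp only: length_groups[OF assms(3)])
  show "runs_within M (group_prog k) (init (Node d (enc_list (map enc_row vs))))
      (5 * N + length vs * (10 * D + k + 8) + 3 * k + 11)
      (init (Node d (enc_list (map enc_row (rev (groups k vs))))))"
    unfolding group_prog_def
    by (rule runs_within_Seq[OF s1(1) runs_within_Seq[OF s2(1) s3 order_refl]]) simp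
  show "rows_size M (groups k vs) \<le> D" by (rule s2(3))
qed

section \<open>Approximation guarantee\<close>

lemma vec_of_list_scalar_prod:
  "vec_of_list v \<bullet> x = (\<Sum>i<dim_vec x. v ! i * x $ i)"
  by (auto simp: scalar_prod_def vec_of_list_index lessThan_atLeast0)

lemma scalar_prod_le_map2_max:
  fixes x :: "real vec"
  assumes "length v = dim_vec x" "length w = dim_vec x" "\<And>i. i < dim_vec x \<Longrightarrow> 0 \<le> x $ i"
  shows "vec_of_list v \<bullet> x \<le> vec_of_list (map2 max v w) \<bullet> x"
    and "vec_of_list w \<bullet> x \<le> vec_of_list (map2 max v w) \<bullet> x"
proof -
  show "vec_of_list v \<bullet> x \<le> vec_of_list (map2 max v w) \<bullet> x"
    unfolding vec_of_list_scalar_prod by (intro sum_mono mult_right_mono; use assms in simp)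
  show "vec_of_list w \<bullet> x \<le> vec_of_list (map2 max v w) \<bullet> x"
    unfolding vec_of_list_scalar_prod by (intro sum_mono mult_right_mono; use assms in simp)
qed

text \<open>Nonnegative costs give \<open>max a b \<le> a + b\<close> in each coordinate.\<close>

lemma map2_max_scalar_prod_le:
  assumes "length v = dim_vec x" "length w = dim_vec x" "\<And>i. i < dim_vec x \<Longrightarrow> 0 \<le> x $ i"
    and "\<forall>a\<in>set v. 0 \<le> a" "\<forall>a\<in>set w. (0::real) \<le> a"
  shows "vec_of_list (map2 max v w) \<bullet> x \<le> vec_of_list v \<bullet> x + vec_of_list w \<bullet> x"
  unfolding vec_of_list_scalar_prod sum.distrib[symmetric] distrib_right[symmetric]
  by (intro sum_mono mult_right_mono; use assms in auto)

section \<open>Validity and values of the accumulated rows\<close>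

definition valid_row :: "cost_model \<Rightarrow> nat \<Rightarrow> real list \<Rightarrow> bool" where
  "valid_row M N v \<longleftrightarrow> length v = N \<and> (\<forall>a\<in>set v. a \<in> numbers M \<and> 0 \<le> a)"

lemma valid_row_map2_max:
  "valid_row M N v \<Longrightarrow> valid_row M N w \<Longrightarrow> valid_row M N (map2 max v w)"
  by (auto simp: valid_row_def max_def) (blast dest: set_zip_leftD set_zip_rightD)+

lemma valid_row_step:
  assumes "L \<noteq> []" "\<forall>w\<in>set L. valid_row M N w" "valid_row M N v"
  shows "\<forall>w\<in>set (step L v). valid_row M N w"
  using assms by (cases L) (auto simp: step_def intro!: valid_row_map2_max)

lemma step_not_Nil [simp]: "step L v \<noteq> []"
  by (simp add: step_def)

lemma valid_row_foldl_step:
  assumes "L \<noteq> []" "\<forall>w\<in>set L. valid_row M N w" "\<forall>v\<in>set vs. valid_row M N v"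
  shows "\<forall>w\<in>set (foldl step L vs). valid_row M N w"
  using assms
proof (induction vs arbitrary: L)
  case (Cons v vs)
  have "\<forall>w\<in>set (foldl step (step L v) vs). valid_row M N w"
    using Cons.prems by (intro Cons.IH valid_row_step) auto
  then show ?case by simp
qed simp

text \<open>Rows already absorbed are represented only through the accumulators, so the induction
  covers \<open>set L\<close> along with the rows still to come.\<close>

lemma foldl_step_dominates:
  assumes "L \<noteq> []" "\<forall>w\<in>set L. valid_row M (dim_vec x) w" "\<forall>v\<in>set vs. valid_row M (dim_vec x) v"
    and "\<And>i. i < dim_vec x \<Longrightarrow> 0 \<le> x $ i" "u \<in> set L \<union> set vs"
  shows "\<exists>w\<in>set (foldl step L vs). vec_of_list u \<bullet> x \<le> vec_of_list w \<bullet> x"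
  using assms(1-3,5)
proof (induction vs arbitrary: L u)
  case (Cons v vs)
  obtain h T where L: "L = h # T" using Cons.prems(1) by (cases L) auto
  let ?m = "map2 max v h"
  have IH: "\<exists>w\<in>set (foldl step (step L v) vs). vec_of_list y \<bullet> x \<le> vec_of_list w \<bullet> x"
    if "y \<in> set (step L v) \<union> set vs" for y
    by (rule Cons.IH) (use that Cons.prems valid_row_step[of L M "dim_vec x" v] in auto)
  have "vec_of_list v \<bullet> x \<le> vec_of_list ?m \<bullet> x" "vec_of_list h \<bullet> x \<le> vec_of_list ?m \<bullet> x"
    using Cons.prems(2,3) L assms(4) by (intro scalar_prod_le_map2_max; simp add: valid_row_def)+
  moreover have "?m \<in> set (step L v)" "set T \<subseteq> set (step L v)"
    by (auto simp: step_def L)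
  \<comment> \<open>\<open>h\<close> and \<open>v\<close> are both dominated by \<open>?m\<close>;
    every other row survives the round unchanged.\<close>
  moreover have "u = h \<or> u = v \<or> u \<in> set T \<or> u \<in> set vs"
    using Cons.prems(4) L by auto
  ultimately have "\<exists>y \<in> set (step L v) \<union> set vs. vec_of_list u \<bullet> x \<le> vec_of_list y \<bullet> x"
    by blast
  then show ?case using IH order_trans by fastforce
qed auto

text \<open>After \<open>i\<close> steps the accumulator in position \<open>p\<close> has absorbed \<open>(i + p) div k\<close> scenarios.\<close>

lemma foldl_step_scalar_prod_le:
  assumes "L \<noteq> []" "\<forall>w\<in>set L. valid_row M (dim_vec x) w" "\<forall>v\<in>set vs. valid_row M (dim_vec x) v"
    and "\<And>i. i < dim_vec x \<Longrightarrow> 0 \<le> x $ i"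
    and "\<forall>v\<in>set vs. vec_of_list v \<bullet> x \<le> B"
    and "\<forall>p<length L. vec_of_list (L ! p) \<bullet> x \<le> B * real ((i + p) div length L)"
    and "p < length L"
  shows "vec_of_list (foldl step L vs ! p) \<bullet> x \<le> B * real ((i + length vs + p) div length L)"
  using assms(1-3,5-7)
proof (induction vs arbitrary: L i)
  case (Cons v vs)
  let ?k = "length L"
  have "vec_of_list (step L v ! q) \<bullet> x \<le> B * real ((Suc i + q) div ?k)" if "q < ?k" for q
  proof (cases "Suc q < ?k")
    case True
    \<comment> \<open>The accumulator moves from position \<open>Suc q\<close> to \<open>q\<close>,
      and \<open>i + Suc q = Suc i + q\<close>, so its bound is inherited.\<close>
    then show ?thesis using Cons.prems(5) by (auto simp: step_def nth_append nth_tl)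
  next
    case False
    then have q: "q = ?k - 1" using that by simp
    have "vec_of_list (map2 max v (hd L)) \<bullet> x \<le> vec_of_list v \<bullet> x + vec_of_list (hd L) \<bullet> x"
      using Cons.prems(1-3) assms(4) by (intro map2_max_scalar_prod_le) (auto simp: valid_row_def)
    also have "\<dots> \<le> B + B * real ((i + 0) div ?k)"
      using Cons.prems(1,4,5) by (intro add_mono) (auto simp: hd_conv_nth)
    \<comment> \<open>The additional \<open>B\<close> for the absorbed scenario is the quotient
      advancing by one.\<close>
    also have "\<dots> = B * real ((i + ?k) div ?k)"
      using Cons.prems(1) by (simp add: distrib_left)
    also have "i + ?k = Suc i + q" using q Cons.prems(1) by (cases L) auto
    finally show ?thesis using q by (simp add: step_def nth_append)
  qed
  then have "vec_of_list (foldl step (step L v) vs ! p) \<bullet> x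
      \<le> B * real ((Suc i + length vs + p) div length (step L v))"
    using Cons.prems valid_row_step[of L M "dim_vec x" v] by (intro Cons.IH) auto
  then show ?case using Cons.prems(1) by simp
qed simp

lemma zero_in_numbers: "0 \<in> numbers M"
  by (cases M) auto

lemma valid_row_groups:
  assumes "vs \<noteq> []" "\<forall>v\<in>set vs. valid_row M N v" "k \<ge> 1"
  shows "\<forall>w\<in>set (groups k vs). valid_row M N w"
  unfolding groups_def
  by (rule valid_row_foldl_step)
    (use assms in \<open>auto simp: zero_in_numbers valid_row_def split: if_splits\<close>)

lemma groups_dominate:
  assumes "vs \<noteq> []" "\<forall>v\<in>set vs. valid_row M (dim_vec x) v" "k \<ge> 1"
    and "\<And>i. i < dim_vec x \<Longrightarrow> 0 \<le> x $ i" "u \<in> set vs"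
  shows "\<exists>w\<in>set (groups k vs). vec_of_list u \<bullet> x \<le> vec_of_list w \<bullet> x"
  unfolding groups_def
  by (rule foldl_step_dominates[where M = M])
    (use assms in \<open>auto simp: zero_in_numbers valid_row_def split: if_splits\<close>)

text \<open>The zero rows meet the initial bound with \<open>i = 0\<close>, as
  \<open>q div k = 0\<close> for \<open>q < k\<close>. Position \<open>k - 1\<close> has the largest
  bound, and \<open>(K + k - 1) div k\<close> is K / k rounded up.\<close>

lemma groups_scalar_prod_le:
  assumes "vs \<noteq> []" "\<forall>v\<in>set vs. valid_row M (dim_vec x) v" "k \<ge> 1"
    and x: "\<And>i. i < dim_vec x \<Longrightarrow> 0 \<le> x $ i"
    and B: "\<forall>v\<in>set vs. vec_of_list v \<bullet> x \<le> B" "0 \<le> B" and "w \<in> set (groups k vs)"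
  shows "vec_of_list w \<bullet> x \<le> B * real ((length vs + k - 1) div k)"
proof -
  let ?L = "replicate k (replicate (length (hd vs)) (0::real))"
  have hd: "length (hd vs) = dim_vec x" using assms(1,2) by (auto simp: valid_row_def)
  obtain p where p: "p < k" "w = groups k vs ! p"
    using assms(3,7) by (auto simp: in_set_conv_nth length_groups)
  have "vec_of_list (?L ! q) \<bullet> x = 0" if "q < k" for q
    using that hd by (simp add: vec_of_list_scalar_prod)
  then have "vec_of_list (foldl step ?L vs ! p) \<bullet> x \<le> B * real ((0 + length vs + p) div length ?L)"
    using assms p hd
    by (intro foldl_step_scalar_prod_le[where M = M]) (auto simp: zero_in_numbers valid_row_def split: if_splits)
  also have "\<dots> \<le> B * real ((length vs + k - 1) div k)"
    using p(1) B(2) by (intro mult_left_mono) (auto intro!: div_le_mono)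
  finally show ?thesis by (simp add: p(2) groups_def)
qed

section \<open>From values of single scenarios to min-max values\<close>

lemma max_cost_le_iff:
  assumes "cs \<noteq> []"
  shows "max_cost cs x \<le> b \<longleftrightarrow> (\<forall>c\<in>set cs. c \<bullet> x \<le> b)"
  unfolding max_cost_def using assms
  by (subst Max_le_iff) (auto simp: all_set_conv_all_nth lessThan_empty_iff)

lemma scalar_prod_le_max_cost: "c \<in> set cs \<Longrightarrow> c \<bullet> x \<le> max_cost cs x"
  using max_cost_le_iff[of cs x "max_cost cs x"] by (cases cs) auto

text \<open>\<open>minmax\<close> is a \<open>Min\<close>, whose characteristic properties require a
  finite set.\<close>

lemma finite_binary_vecs: "finite (binary_vecs m)"
proof (rule finite_subset)
  show "binary_vecs m \<subseteq> vec_of_list ` {l. set l \<subseteq> {0, 1} \<and> length l = m}"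
  proof
    fix x :: "real vec"
    assume "x \<in> binary_vecs m"
    then have "set (list_of_vec x) \<subseteq> {0, 1}" "length (list_of_vec x) = m"
      by (auto simp: binary_vecs_def set_list_of_vec vec_set_def)
    then show "x \<in> vec_of_list ` {l. set l \<subseteq> {0, 1} \<and> length l = m}"
      by (auto intro!: image_eqI[where x = "list_of_vec x"] simp: vec_list)
  qed
  show "finite (vec_of_list ` {l :: real list. set l \<subseteq> {0, 1} \<and> length l = m})"
    by (intro finite_imageI finite_lists_length_eq) auto
qed

text \<open>For an original optimum \<open>z\<close>, the original cost of \<open>y\<close> is at
  most its grouped cost, hence at most twice the grouped cost of \<open>z\<close>, hence at most
  \<open>2 * ?m\<close> times the original cost of \<open>z\<close>. The sign of the optimum is
  recorded so that this factor can be enlarged later.\<close>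

lemma approximation_groups:
  assumes F: "F \<noteq> {}" "F \<subseteq> binary_vecs N"
    and vs: "vs \<noteq> []" "\<forall>v\<in>set vs. valid_row M N v" and "k \<ge> 1"
    and appr: "approximation 2 F (map vec_of_list (rev (groups k vs))) y"
  shows "approximation (2 * real ((length vs + k - 1) div k)) F (map vec_of_list vs) y"
    and "0 \<le> minmax F (map vec_of_list vs)"
proof -
  let ?cs = "map vec_of_list vs"
  let ?ds = "map vec_of_list (rev (groups k vs))"
  let ?m = "real ((length vs + k - 1) div k)"
  have fin: "finite F" using F(2) finite_binary_vecs finite_subset by blast
  have x: "dim_vec x = N" "\<And>i. i < dim_vec x \<Longrightarrow> 0 \<le> x $ i" if "x \<in> F" for x
    using that F(2) by (force simp: binary_vecs_def)+
  have ne: "?cs \<noteq> []" "?ds \<noteq> []"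
    using vs(1) length_groups[OF \<open>k \<ge> 1\<close>, of vs] \<open>k \<ge> 1\<close> by auto
  have nonneg: "0 \<le> max_cost ?cs x" if "x \<in> F" for x
  proof -
    have "valid_row M N (hd vs)" using vs by simp
    then have "0 \<le> vec_of_list (hd vs) \<bullet> x"
      using x[OF that]
      by (auto simp: vec_of_list_scalar_prod valid_row_def intro!: sum_nonneg mult_nonneg_nonneg)
    also have "\<dots> \<le> max_cost ?cs x"
      using vs(1) by (intro scalar_prod_le_max_cost) auto
    finally show ?thesis .
  qed
  have "minmax F ?cs \<in> max_cost ?cs ` F"
    unfolding minmax_def using fin F(1) by (intro Min_in) auto
  then obtain z where z: "z \<in> F" "minmax F ?cs = max_cost ?cs z" by auto
  then show "0 \<le> minmax F ?cs" using nonneg by simp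
  have y: "y \<in> F" "max_cost ?ds y \<le> 2 * minmax F ?ds"
    using appr by (auto simp: approximation_def)
  have "max_cost ?cs y \<le> max_cost ?ds y"
    unfolding max_cost_le_iff[OF ne(1)]
  proof
    fix c assume "c \<in> set ?cs"
    then obtain u where "u \<in> set vs" "c = vec_of_list u" by auto
    moreover obtain w where "w \<in> set (groups k vs)" "vec_of_list u \<bullet> y \<le> vec_of_list w \<bullet> y"
      using groups_dominate[of vs M y k u] vs x[OF y(1)] \<open>k \<ge> 1\<close> calculation by auto
    moreover have "vec_of_list w \<bullet> y \<le> max_cost ?ds y"
      using calculation by (intro scalar_prod_le_max_cost) auto
    ultimately show "c \<bullet> y \<le> max_cost ?ds y" by simp
  qed
  also note y(2)
  also have "minmax F ?ds \<le> max_cost ?ds z"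
    unfolding minmax_def using fin z(1) by (intro Min_le) auto
  also have "max_cost ?ds z \<le> max_cost ?cs z * ?m"
    unfolding max_cost_le_iff[OF ne(2)]
  proof
    fix d assume "d \<in> set ?ds"
    then obtain w where w: "w \<in> set (groups k vs)" "d = vec_of_list w" by auto
    have "\<forall>v\<in>set vs. vec_of_list v \<bullet> z \<le> max_cost ?cs z"
      by (auto intro: scalar_prod_le_max_cost)
    then show "d \<bullet> z \<le> max_cost ?cs z * ?m"
      unfolding w(2) using vs x[OF z(1)] \<open>k \<ge> 1\<close> nonneg[OF z(1)] w(1)
      by (intro groups_scalar_prod_le) auto
  qed
  finally show "approximation (2 * ?m) F ?cs y"
    using y(1) z(2) by (simp add: approximation_def mult_ac)
qed

text \<open>If \<open>K \<le> k\<close>, each group has at most one member and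
  \<open>2 \<le> \<epsilon> * K\<close> suffices. Otherwise rounding up at most doubles K / k;
  together with the approximation factor 2 this explains the constant 4.\<close>

lemma group_size_bound:
  fixes \<epsilon> :: real
  assumes "0 < \<epsilon>" "4 / \<epsilon> \<le> real k" "2 \<le> \<epsilon> * real K" "k \<ge> 1"
  shows "2 * real ((K + k - 1) div k) \<le> \<epsilon> * real K"
proof (cases "K \<le> k")
  case True
  then have "(K + k - 1) div k \<le> (2 * k - 1) div k" by (intro div_le_mono) auto
  also have "\<dots> \<le> 1" using \<open>k \<ge> 1\<close> by (simp add: less_Suc_eq_le[symmetric] div_less_iff_less_mult)
  finally show ?thesis using assms(3) by linarith
next
  case False
  have k: "4 \<le> \<epsilon> * k" using assms(1,2) by (simp add: field_simps)
  let ?m = "(K + k - 1) div k"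
  have "?m * k \<le> K + k - 1" by simp
  also have "\<dots> \<le> 2 * K" using False by simp
  finally have "real ?m * real k \<le> 2 * real K"
    by (metis of_nat_le_iff of_nat_mult of_nat_numeral)
  then have "\<epsilon> * (real ?m * real k) \<le> \<epsilon> * (2 * real K)"
    using assms(1) by (intro mult_left_mono) auto
  moreover have "real ?m * 4 \<le> real ?m * (\<epsilon> * k)" using k by (intro mult_left_mono) auto
  ultimately show ?thesis by (simp add: mult_ac)
qed

lemma poly_nat_mono: "a \<le> b \<Longrightarrow> poly p a \<le> poly p (b :: nat)"
  by (induction p) (auto intro!: add_mono mult_mono)

text \<open>For \<open>\<epsilon> * K < 1\<close> the bound would undercut any positive optimum, and
  between 1 and 2 it would demand a better factor than the hypothesis directly supplies. The
  guarantee is thus conditional on \<open>2 \<le> \<epsilon> * K\<close>, while feasibility always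
  holds.\<close>

theorem theorem1:
  fixes M :: cost_model
    and codes :: "real tree set"
    and n :: "real tree \<Rightarrow> nat"
    and X :: "real tree \<Rightarrow> real vec set"
    and \<epsilon> :: real
  assumes "problem_class M codes n X"
    and "\<forall>K\<ge>1. polytime_solvable M {(e, cs) \<in> instances M codes n. length cs = K}
                 (\<lambda>e cs x. approximation 2 (X e) cs x)"
    and "0 < \<epsilon>" and "\<epsilon> \<le> 1"
  shows "polytime_solvable M (instances M codes n)
           (\<lambda>e cs x. x \<in> X e \<and>
              (\<epsilon> * real (length cs) \<ge> 2 \<longrightarrow> approximation (\<epsilon> * real (length cs)) (X e) cs x))"
proof -
  \<comment> \<open>\<open>k\<close> depends on \<open>\<epsilon>\<close> alone, so one grouping
    program and one 2-approximation program serve all instances.\<close>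
  define k where "k = nat \<lceil>4 / \<epsilon>\<rceil>"
  have k: "4 / \<epsilon> \<le> real k" unfolding k_def by linarith
  have "0 < 4 / \<epsilon>" using assms(3) by simp
  then have k1: "k \<ge> 1" using k by linarith
  obtain prog p where prog: "\<And>e cs. (e, cs) \<in> instances M codes n \<Longrightarrow> length cs = k \<Longrightarrow>
      \<exists>t s x. runs M prog (init (enc_instance (e, cs))) t s \<and>
        t \<le> poly p (tree_size M (enc_instance (e, cs))) \<and>
        s 0 = enc_vec x \<and> approximation 2 (X e) cs x"
    using assms(2)[rule_format, OF k1] unfolding polytime_solvable_def by fast
  \<comment> \<open>For input size \<open>S\<close>, \<open>c * S\<close> bounds the given rows (at
    most \<open>S\<close>) together with \<open>k\<close> zero rows, each of size at most
    \<open>S * (2 + num_size M 0)\<close>.\<close>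
  define c where "c = 1 + k * (2 + num_size M 0)"
  \<comment> \<open>The first summand bounds the grouping time; the second evaluates
    \<open>p\<close> at \<open>k + (1 + c) * S\<close>, a bound on the size of the grouped
    instance.\<close>
  define q where "q = [:3 * k + 11, k + 13, 10 * c:] + pcompose p [:k, 1 + c:]"
  have "\<exists>t s x. runs M (Seq (group_prog k) prog) (init (enc_instance (e, cs))) t s \<and>
      t \<le> poly q (tree_size M (enc_instance (e, cs))) \<and> s 0 = enc_vec x \<and> x \<in> X e \<and>
      (\<epsilon> * real (length cs) \<ge> 2 \<longrightarrow> approximation (\<epsilon> * real (length cs)) (X e) cs x)"
    if inst: "(e, cs) \<in> instances M codes n" for e cs
  proof -
    define vs where "vs = map list_of_vec cs"
    define ds where "ds = map vec_of_list (rev (groups k vs))"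
    define S where "S = tree_size M (enc_instance (e, cs))"
    have ne: "vs \<noteq> []" and e: "e \<in> codes" and cs: "cs = map vec_of_list vs"
      using inst by (auto simp: instances_def vs_def vec_list comp_def)
    have valid: "\<forall>v\<in>set vs. valid_row M (n e) v"
      using inst by (auto simp: instances_def vs_def valid_row_def set_list_of_vec vec_set_def)
    then have len: "\<forall>v\<in>set vs. length v = n e" by (simp add: valid_row_def)
    have valid_groups: "\<forall>w\<in>set (groups k vs). valid_row M (n e) w"
      by (rule valid_row_groups[OF ne valid k1])
    have enc_cs: "enc_instance (e, cs) = Node e (enc_list (map enc_row vs))"
      by (simp add: enc_instance_def enc_vec_def[abs_def] vs_def comp_def)
    have enc_ds: "enc_instance (e, ds) = Node e (enc_list (map enc_row (rev (groups k vs))))"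
      by (simp add: enc_instance_def enc_vec_def[abs_def] ds_def comp_def list_vec)
    have S: "S = 2 + tree_size M e + length vs + rows_size M vs"
      by (simp add: S_def enc_cs tree_size_enc_list sum_list_addf sum_list_triv comp_def sum_list_Suc)
    have "tree_size M (enc_row (hd vs)) \<le> rows_size M vs"
      using ne by (cases vs) auto
    then have nS: "n e + 1 \<le> S"
      using length_le_tree_size_enc_row[of "hd vs" M] S len ne by simp
    have "tree_size M (enc_row (replicate (n e) 0)) \<le> (n e + 1) * (2 + num_size M 0)"
      unfolding tree_size_zero_row by simp
    also have "\<dots> \<le> S * (2 + num_size M 0)" using nS by (rule mult_le_mono1)
    finally have "k * tree_size M (enc_row (replicate (n e) 0)) \<le> k * (S * (2 + num_size M 0))"
      by (rule mult_le_mono2)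
    then have D: "rows_size M vs + k * tree_size M (enc_row (replicate (n e) 0)) \<le> c * S"
      using S by (simp add: c_def algebra_simps)
    obtain t1 where t1: "runs M (group_prog k) (init (enc_instance (e, cs))) t1
        (init (enc_instance (e, ds)))"
      "t1 \<le> 5 * n e + length vs * (10 * (c * S) + k + 8) + 3 * k + 11"
      using runs_group_prog(1)[OF ne len k1 D, of e]
      unfolding runs_within_def enc_cs enc_ds by blast
    have "length vs * (10 * (c * S) + k + 8) \<le> S * (10 * (c * S) + k + 8)"
      by (rule mult_le_mono1) (simp add: S)
    then have "t1 \<le> 5 * S + S * (10 * (c * S) + k + 8) + 3 * k + 11"
      using t1(2) nS by linarith
    also have "\<dots> = poly [:3 * k + 11, k + 13, 10 * c:] S"
      by (simp add: algebra_simps)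
    finally have t1_le: "t1 \<le> poly [:3 * k + 11, k + 13, 10 * c:] S" .
    have len_ds: "length ds = k"
      by (simp add: ds_def length_groups[OF k1])
    have "d \<in> carrier_vec (n e) \<and> (\<forall>j<n e. d $ j \<in> numbers M \<and> 0 \<le> d $ j)" if d_in: "d \<in> set ds" for d
    proof -
      obtain w where "w \<in> set (groups k vs)" and d: "d = vec_of_list w"
        using d_in by (auto simp: ds_def)
      then have w: "length w = n e" "\<And>a. a \<in> set w \<Longrightarrow> a \<in> numbers M \<and> 0 \<le> a"
        using valid_groups by (auto simp: valid_row_def)
      have "d $ j \<in> numbers M \<and> 0 \<le> d $ j" if "j < n e" for j
        unfolding d vec_of_list_index by (rule w(2)) (use w(1) that in simp)
      moreover have "d \<in> carrier_vec (n e)" unfolding d by (rule carrier_vecI) (simp add: w(1))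
      ultimately show ?thesis by blast
    qed
    moreover have "ds \<noteq> []" using len_ds k1 by auto
    ultimately have "(e, ds) \<in> instances M codes n" using e by (simp add: instances_def)
    from prog[OF this len_ds] obtain t2 s x where t2: "runs M prog (init (enc_instance (e, ds))) t2 s"
      "t2 \<le> poly p (tree_size M (enc_instance (e, ds)))" "s 0 = enc_vec x"
      "approximation 2 (X e) ds x"
      by blast
    have "rows_size M (rev (groups k vs)) = rows_size M (groups k vs)"
      by (simp add: rev_map[symmetric])
    then have "tree_size M (enc_instance (e, ds)) = 2 + tree_size M e + k + rows_size M (groups k vs)"
      by (simp add: enc_ds tree_size_enc_list comp_def sum_list_Suc length_groups[OF k1])
    also have "\<dots> \<le> k + (1 + c) * S"
      using runs_group_prog(2)[OF ne len k1 D] S by simp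
    finally have "poly p (tree_size M (enc_instance (e, ds))) \<le> poly p (k + (1 + c) * S)"
      by (rule poly_nat_mono)
    then have "t1 + t2 \<le> poly q S"
      using t1_le t2(2) by (simp add: q_def poly_pcompose mult_ac)
    moreover have "runs M (Seq (group_prog k) prog) (init (enc_instance (e, cs))) (t1 + t2) s"
      using t1(1) t2(1) by (rule runs.Seq)
    moreover have F: "X e \<noteq> {}" "X e \<subseteq> binary_vecs (n e)"
      using assms(1) e by (auto simp: problem_class_def)
    note appr = approximation_groups[OF F ne valid k1 t2(4)[unfolded ds_def], folded cs]
    have "approximation (\<epsilon> * real (length cs)) (X e) cs x" if "\<epsilon> * real (length cs) \<ge> 2"
    proof -
      \<comment> \<open>Enlarging the factor preserves the bound because the optimum is
        nonnegative.\<close>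
      have "2 * real ((length vs + k - 1) div k) * minmax (X e) cs
          \<le> \<epsilon> * real (length cs) * minmax (X e) cs"
        using group_size_bound[OF assms(3) k that k1] appr(2)
        by (intro mult_right_mono) (auto simp: vs_def)
      then show ?thesis using appr(1) by (auto simp: approximation_def)
    qed
    moreover have "x \<in> X e" using appr(1) by (simp add: approximation_def)
    ultimately show ?thesis using t2(3) unfolding S_def by blast
  qed
  then show ?thesis unfolding polytime_solvable_def by blast
qed

end
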